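(* Let $S_n$ be the symmetric group on $\{1,\dots,n\}$ equipped with the uniform probability measure $\pi_n$. For $f:S_n\to\mathbb R$ and $\sigma\in S_n$ put $$\Gamma(f)(\sigma)^2=\frac1n\sum_{i,j=1}^n\big(f(\sigma)-f(\sigma\tau_{ij})\big)^2,\qquad \Gamma^+(f)(\sigma)^2=\frac1n\sum_{i,j=1}^n\big(f(\sigma)-f(\sigma\tau_{ij})\big)_+^2 .$$ Then $\pi_n$ satisfies a $\Gamma\mathrm{-mLSI}(1)$ and a $\Gamma^+\mathrm{-mLSI}(2)$; that is, for all $f:S_n\to\mathbb R$ $$\mathrm{Ent}_{\pi_n}(e^f)\le\frac12\,\mathbb E_{\pi_n}\big(\Gamma(f)^2e^f\big)\quad\text{and}\quad \mathrm{Ent}_{\pi_n}(e^f)\le\mathbb E_{\pi_n}\big(\Gamma^+(f)^2e^f\big).$$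
   Context: $\tau_{ij}$ denotes the transposition of $i$ and $j$ ($\tau_{ii}$ is the identity), the group operation on $S_n$ is written $\tau\sigma$ (composition, so $(\sigma\tau_{ij})(k)=\sigma(\tau_{ij}(k))$), $y_+=\max(y,0)$, and $\Gamma(f),\Gamma^+(f)\ge0$ are the non-negative square roots. For $h\ge0$, $\mathrm{Ent}_\mu(h)=\mathbb E_\mu h\log h-\mathbb E_\mu h\,\log(\mathbb E_\mu h)$. A probability measure $\mu$ satisfies a $\Gamma\mathrm{-mLSI}(\rho)$ if $\mathrm{Ent}_\mu(e^f)\le\frac\rho2\mathbb E_\mu(\Gamma(f)^2e^f)$ for all $f$ in the domain of $\Gamma$ (here: all functions $S_n\to\mathbb R$). *)

theory Defs
  imports "HOL-Probability.Probability" "HOL-Combinatorics.Permutations"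
begin

(* Permutations of {1..n} are functions on nat fixing every point outside {1..n}. *)
definition Sym :: "nat \<Rightarrow> (nat \<Rightarrow> nat) set" where
  "Sym n = {\<sigma>. \<sigma> permutes {1..n}}"

definition unif_Sym :: "nat \<Rightarrow> (nat \<Rightarrow> nat) measure" where
  "unif_Sym n = measure_pmf (pmf_of_set (Sym n))"

(* Meant for h \<ge> 0 with h and h * ln h integrable; ln 0 = 0 gives the
   convention 0 * ln 0 = 0. *)
definition Ent :: "'a measure \<Rightarrow> ('a \<Rightarrow> real) \<Rightarrow> real" where
  "Ent M h = (\<integral>x. h x * ln (h x) \<partial>M) - (\<integral>x. h x \<partial>M) * ln (\<integral>x. h x \<partial>M)"

(* D is the domain of the operator G. *)
definition mLSI ::
  "'a measure \<Rightarrow> ('a \<Rightarrow> real) set \<Rightarrow> (('a \<Rightarrow> real) \<Rightarrow> 'a \<Rightarrow> real) \<Rightarrow> real \<Rightarrow> bool" where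
  "mLSI M D G \<rho> \<longleftrightarrow> prob_space M \<and>
     (\<forall>f\<in>D. Ent M (\<lambda>x. exp (f x)) \<le> \<rho> / 2 * (\<integral>x. (G f x)\<^sup>2 * exp (f x) \<partial>M))"

(* Both operators read f only on Sym n when evaluated at an element of Sym n, so
   functions on all of nat => nat stand for functions on Sym n.  The name transpose
   is qualified because of matrix transposition. *)
definition Gamma_Sym :: "nat \<Rightarrow> ((nat \<Rightarrow> nat) \<Rightarrow> real) \<Rightarrow> (nat \<Rightarrow> nat) \<Rightarrow> real" where
  "Gamma_Sym n f \<sigma> = sqrt (1 / real n *
     (\<Sum>i=1..n. \<Sum>j=1..n. (f \<sigma> - f (\<sigma> \<circ> Transposition.transpose i j))\<^sup>2))"

definition Gamma_Sym_plus :: "nat \<Rightarrow> ((nat \<Rightarrow> nat) \<Rightarrow> real) \<Rightarrow> (nat \<Rightarrow> nat) \<Rightarrow> real" where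
  "Gamma_Sym_plus n f \<sigma> = sqrt (1 / real n *
     (\<Sum>i=1..n. \<Sum>j=1..n. (max (f \<sigma> - f (\<sigma> \<circ> Transposition.transpose i j)) 0)\<^sup>2))"

end

theory Submission
  imports Defs
begin

text \<open>
  The entropy is bounded by the symmetrised Dirichlet form
  \<open>1/(2n) \<Sum>\<^sub>i\<^sub>j E (h - h\<^sub>i\<^sub>j) (ln h - ln h\<^sub>i\<^sub>j)\<close> with \<open>h = exp f\<close>, by induction on \<open>n\<close>: split
  the entropy by conditioning on \<open>\<sigma> k\<close>, bound the conditional entropies by the induction
  hypothesis, bound the entropy of the conditional means by their covariance with their
  logarithms, and average over \<open>k\<close>. The covariance is controlled by the joint convexity of
  \<open>(x, y) \<mapsto> (x - y) (ln x - ln y)\<close> and the coupling of \<open>{\<sigma> k = l}\<close> and \<open>{\<sigma> k = m}\<close> that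
  multiplies by the transposition of \<open>l\<close> and \<open>m\<close>. With constant \<open>1/n\<close> the recursion closes because
  \<open>(n - 2) / (n (n - 1)) + 1/n\<^sup>2 \<le> 1/n\<close>. Finally
  \<open>(exp a - exp b) (a - b) \<le> (a - b)\<^sup>2 (exp a + exp b) / 2\<close>.
\<close>

hide_const (open) Finite_Cartesian_Product.transpose

section \<open>Convexity inequalities for logarithms\<close>

text \<open>Sum the bound \<open>ln t \<le> t - 1\<close> at \<open>t = b x * r / a x\<close> with
  weights \<open>a x\<close>; choosing \<open>r\<close> as the ratio of the two totals makes the
  terms \<open>a x - b x * r\<close> sum to zero.\<close>

lemma log_sum_inequality:
  fixes a b :: "'a \<Rightarrow> real"
  assumes "finite S" and a: "\<And>x. x \<in> S \<Longrightarrow> a x > 0" and b: "\<And>x. x \<in> S \<Longrightarrow> b x > 0"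
  shows "sum a S * (ln (sum a S) - ln (sum b S)) \<le> (\<Sum>x\<in>S. a x * (ln (a x) - ln (b x)))"
proof (cases "S = {}")
  case False
  define r where "r = sum a S / sum b S"
  have pos: "sum a S > 0" "sum b S > 0"
    using False assms by (auto intro: sum_pos)
  then have r: "r > 0" "sum b S * r = sum a S" "ln r = ln (sum a S) - ln (sum b S)"
    by (simp_all add: r_def ln_div)
  have "a x - b x * r \<le> a x * (ln (a x) - ln (b x) - ln r)" if "x \<in> S" for x
  proof -
    have "ln (b x * r / a x) \<le> b x * r / a x - 1"
      using a b r that by (intro ln_le_minus_one) auto
    then have "a x * ln (b x * r / a x) \<le> a x * (b x * r / a x - 1)"
      using a[OF that] by (intro mult_left_mono) auto
    then show ?thesis
      using a[OF that] b[OF that] r(1) by (simp add: ln_div ln_mult algebra_simps)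
  qed
  then have "(\<Sum>x\<in>S. a x - b x * r) \<le> (\<Sum>x\<in>S. a x * (ln (a x) - ln (b x) - ln r))"
    by (rule sum_mono)
  also have "\<dots> = (\<Sum>x\<in>S. a x * (ln (a x) - ln (b x))) - sum a S * ln r"
    by (simp add: right_diff_distrib sum_subtractf sum_distrib_right)
  also have "(\<Sum>x\<in>S. a x - b x * r) = 0"
    using r by (simp add: sum_subtractf flip: sum_distrib_right)
  finally show ?thesis
    using r by simp
qed simp

definition sym_div :: "real \<Rightarrow> real \<Rightarrow> real" where
  "sym_div x y = (x - y) * (ln x - ln y)"

lemma sym_div_same [simp]: "sym_div x x = 0"
  by (simp add: sym_div_def)

lemma sym_div_nonneg: "x > 0 \<Longrightarrow> y > 0 \<Longrightarrow> sym_div x y \<ge> 0"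
  by (cases "x \<le> y") (auto simp: sym_div_def intro: mult_nonpos_nonpos)

text \<open>\<open>sym_div x y\<close> is the symmetrised divergence
  \<open>x * ln (x / y) + y * ln (y / x)\<close>, so the log-sum inequality applies to each half. As
  \<open>sym_div\<close> is homogeneous of degree one, this subadditivity amounts to joint
  convexity.\<close>

lemma sym_div_sum_le:
  assumes "finite S" "\<And>x. x \<in> S \<Longrightarrow> a x > 0" "\<And>x. x \<in> S \<Longrightarrow> b x > 0"
  shows "sym_div (sum a S) (sum b S) \<le> (\<Sum>x\<in>S. sym_div (a x) (b x))"
proof -
  have "sym_div (sum a S) (sum b S) =
      sum a S * (ln (sum a S) - ln (sum b S)) + sum b S * (ln (sum b S) - ln (sum a S))"
    by (simp add: sym_div_def algebra_simps)
  also have "\<dots> \<le> (\<Sum>x\<in>S. a x * (ln (a x) - ln (b x))) + (\<Sum>x\<in>S. b x * (ln (b x) - ln (a x)))"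
    using assms by (intro add_mono log_sum_inequality) auto
  also have "\<dots> = (\<Sum>x\<in>S. sym_div (a x) (b x))"
    unfolding sym_div_def sum.distrib[symmetric] by (intro sum.cong) (auto simp: algebra_simps)
  finally show ?thesis .
qed

text \<open>Under the uniform measure on \<open>A\<close>, the left side is \<open>card A\<close>
  times the entropy of \<open>g\<close> and the right side \<open>card A\<close> times the
  covariance of \<open>g\<close> and \<open>ln g\<close>. They differ only in \<open>ln\<close> of
  the mean versus the mean of \<open>ln\<close>, so Jensen's inequality suffices.\<close>

lemma sum_ln_le_sum_sym_div:
  fixes g :: "'a \<Rightarrow> real"
  assumes fin: "finite A" and ne: "A \<noteq> {}" and g: "\<And>x. x \<in> A \<Longrightarrow> g x > 0"
  shows "(\<Sum>x\<in>A. g x * ln (g x)) - sum g A * (ln (sum g A) - ln (real (card A)))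
    \<le> (\<Sum>x\<in>A. \<Sum>y\<in>A. sym_div (g x) (g y)) / (2 * real (card A))"
proof -
  let ?n = "real (card A)" and ?G = "sum g A"
  have n: "?n > 0" and G: "?G > 0"
    using assms by (auto simp: card_gt_0_iff intro: sum_pos)
  \<comment> \<open>Jensen comes from comparing \<open>g\<close> with its own mean: both families
    have total \<open>?G\<close>, so the left side vanishes.\<close>
  have "(\<Sum>x\<in>A. ?G / ?n) * (ln (\<Sum>x\<in>A. ?G / ?n) - ln (sum g A))
      \<le> (\<Sum>x\<in>A. ?G / ?n * (ln (?G / ?n) - ln (g x)))"
    using n G g fin by (intro log_sum_inequality) auto
  moreover have "(\<Sum>x\<in>A. ?G / ?n) = ?G"
    using n unfolding sum_constant by simp
  ultimately have "0 \<le> ?G / ?n * (\<Sum>x\<in>A. ln (?G / ?n) - ln (g x))"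
    by (simp only: sum_distrib_left diff_self mult_zero_right)
  then have "(\<Sum>x\<in>A. ln (g x)) \<le> ?n * (ln ?G - ln ?n)"
    using n G by (simp add: sum_subtractf ln_div zero_le_mult_iff zero_le_divide_iff)
  then have jensen: "?G * (\<Sum>x\<in>A. ln (g x)) \<le> ?G * (?n * (ln ?G - ln ?n))"
    using G by (intro mult_left_mono) auto
  have "(\<Sum>x\<in>A. \<Sum>y\<in>A. sym_div (g x) (g y)) =
      (\<Sum>x\<in>A. \<Sum>y\<in>A. g x * ln (g x)) - (\<Sum>x\<in>A. \<Sum>y\<in>A. g x * ln (g y))
      - (\<Sum>x\<in>A. \<Sum>y\<in>A. g y * ln (g x)) + (\<Sum>x\<in>A. \<Sum>y\<in>A. g y * ln (g y))"
    by (simp add: sym_div_def algebra_simps sum.distrib sum_subtractf)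
  also have "\<dots> = 2 * (?n * (\<Sum>x\<in>A. g x * ln (g x)) - ?G * (\<Sum>x\<in>A. ln (g x)))"
    unfolding sum_constant sum_distrib_left[symmetric] sum_distrib_right[symmetric]
    by (simp add: algebra_simps)
  finally show ?thesis
    using jensen n by (simp add: field_simps)
qed

section \<open>Fibers of the map evaluating a permutation at a point\<close>

text \<open>Permutations of \<open>A - {k}\<close> are those of \<open>A\<close> fixing
  \<open>k\<close>; the involution given by left multiplication with \<open>transpose k l\<close>
  moves the value at \<open>k\<close> from \<open>k\<close> to \<open>l\<close> and back.\<close>

lemma bij_betw_transpose_fiber:
  assumes "k \<in> A" "l \<in> A"
  shows "bij_betw (\<lambda>\<sigma>. transpose k l \<circ> \<sigma>) {\<sigma>. \<sigma> permutes (A - {k})}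
    {\<sigma>. \<sigma> permutes A \<and> \<sigma> k = l}"
proof (rule bij_betw_byWitness[where f' = "\<lambda>\<sigma>. transpose k l \<circ> \<sigma>"])
  show "(\<lambda>\<sigma>. transpose k l \<circ> \<sigma>) ` {\<sigma>. \<sigma> permutes (A - {k})} \<subseteq> {\<sigma>. \<sigma> permutes A \<and> \<sigma> k = l}"
    using assms
    by (auto intro!: permutes_compose permutes_swap_id intro: permutes_subset
        simp: permutes_not_in)
  show "(\<lambda>\<sigma>. transpose k l \<circ> \<sigma>) ` {\<sigma>. \<sigma> permutes A \<and> \<sigma> k = l} \<subseteq> {\<sigma>. \<sigma> permutes (A - {k})}"
  proof clarify
    fix \<sigma> assume \<sigma>: "\<sigma> permutes A" "l = \<sigma> k"
    then have "transpose k (\<sigma> k) \<circ> \<sigma> permutes A"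
      using assms by (intro permutes_compose permutes_swap_id) auto
    then show "transpose k (\<sigma> k) \<circ> \<sigma> permutes (A - {k})"
      by (rule permutes_superset) auto
  qed
qed (simp_all add: fun_eq_iff)

lemma sum_fibers:
  assumes "finite A" "k \<in> A"
  shows "(\<Sum>\<sigma> | \<sigma> permutes A. F \<sigma>) = (\<Sum>l\<in>A. \<Sum>\<sigma> | \<sigma> permutes A \<and> \<sigma> k = l. F \<sigma>)"
proof -
  have "(\<Sum>l\<in>A. sum F {\<sigma> \<in> {\<sigma>. \<sigma> permutes A}. \<sigma> k = l}) = sum F {\<sigma>. \<sigma> permutes A}"
    using assms by (intro sum.group) (auto simp: finite_permutations permutes_in_image)
  then show ?thesis
    by simp
qed

lemma sum_fiber:
  assumes "k \<in> A" "l \<in> A"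
  shows "(\<Sum>\<sigma> | \<sigma> permutes A \<and> \<sigma> k = l. F \<sigma>) =
    (\<Sum>\<sigma> | \<sigma> permutes (A - {k}). F (transpose k l \<circ> \<sigma>))"
  using sum.reindex_bij_betw[OF bij_betw_transpose_fiber[OF assms], of F] by simp

text \<open>The coupling of two fibers: left multiplication by \<open>transpose l m\<close>
  exchanges the values \<open>l\<close> and \<open>m\<close> and is its own inverse.\<close>

lemma sum_fiber_shift:
  assumes "l \<in> A" "m \<in> A"
  shows "(\<Sum>\<sigma> | \<sigma> permutes A \<and> \<sigma> k = m. F \<sigma>) =
    (\<Sum>\<sigma> | \<sigma> permutes A \<and> \<sigma> k = l. F (transpose l m \<circ> \<sigma>))"
proof (rule sum.reindex_bij_witness[where i = "\<lambda>\<sigma>. transpose l m \<circ> \<sigma>"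
      and j = "\<lambda>\<sigma>. transpose l m \<circ> \<sigma>"])
qed (use assms in \<open>auto intro!: permutes_compose permutes_swap_id simp flip: comp_assoc\<close>)

lemma sum_permutations_shift:
  assumes "i \<in> A" "j \<in> A"
  shows "(\<Sum>\<sigma> | \<sigma> permutes A. F (\<sigma> \<circ> transpose i j)) = (\<Sum>\<sigma> | \<sigma> permutes A. F \<sigma>)"
proof (rule sum.reindex_bij_witness[where i = "\<lambda>\<sigma>. \<sigma> \<circ> transpose i j"
      and j = "\<lambda>\<sigma>. \<sigma> \<circ> transpose i j"])
qed (use assms in \<open>auto intro!: permutes_compose permutes_swap_id simp: fun_eq_iff\<close>)

section \<open>Entropy and Dirichlet form on permutations\<close>

text \<open>For positive \<open>h\<close> this is \<open>fact (card A)\<close> times the entropy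
  under the uniform measure. Without normalisation, fibers add up with no weights.\<close>

definition perm_ent :: "'a set \<Rightarrow> (('a \<Rightarrow> 'a) \<Rightarrow> real) \<Rightarrow> real" where
  "perm_ent A h = (\<Sum>\<sigma> | \<sigma> permutes A. h \<sigma> * ln (h \<sigma>))
    - (\<Sum>\<sigma> | \<sigma> permutes A. h \<sigma>) * (ln (\<Sum>\<sigma> | \<sigma> permutes A. h \<sigma>) - ln (fact (card A)))"

definition perm_form :: "'a set \<Rightarrow> (('a \<Rightarrow> 'a) \<Rightarrow> real) \<Rightarrow> 'a \<Rightarrow> 'a \<Rightarrow> real" where
  "perm_form A h i j = (\<Sum>\<sigma> | \<sigma> permutes A. sym_div (h \<sigma>) (h (\<sigma> \<circ> transpose i j)))"

lemma perm_form_same [simp]: "perm_form A h i i = 0"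
  by (simp add: perm_form_def)

lemma perm_form_nonneg: "(\<And>\<sigma>. h \<sigma> > 0) \<Longrightarrow> perm_form A h i j \<ge> 0"
  by (simp add: perm_form_def sum_nonneg sym_div_nonneg)

text \<open>The chain rule for entropy: the first sum collects the entropies conditional on
  \<open>\<sigma> k = l\<close>, the second part is the entropy of the fiber masses
  \<open>G\<close>. The terms \<open>G l * ln (G l)\<close> cancel, and the logarithm of the
  factorial splits along \<open>card A\<close> times the factorial of
  \<open>card A - 1\<close>.\<close>

lemma perm_ent_chain:
  fixes h :: "('a \<Rightarrow> 'a) \<Rightarrow> real"
  assumes fin: "finite A" and k: "k \<in> A"
  defines "G \<equiv> \<lambda>l. \<Sum>\<sigma> | \<sigma> permutes A \<and> \<sigma> k = l. h \<sigma>"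
  shows "perm_ent A h = (\<Sum>l\<in>A. perm_ent (A - {k}) (\<lambda>\<sigma>. h (transpose k l \<circ> \<sigma>)))
    + ((\<Sum>l\<in>A. G l * ln (G l)) - sum G A * (ln (sum G A) - ln (real (card A))))"
proof -
  have "card A > 0"
    using fin k by (auto simp: card_gt_0_iff)
  moreover have "(fact (card A) :: real) = real (card A) * fact (card (A - {k}))"
    unfolding card.remove[OF fin k] by simp
  ultimately have N: "ln (fact (card A) :: real) = ln (real (card A)) + ln (fact (card (A - {k})))"
    by (simp add: ln_mult)
  have "(\<Sum>l\<in>A. perm_ent (A - {k}) (\<lambda>\<sigma>. h (transpose k l \<circ> \<sigma>))) =
      (\<Sum>l\<in>A. (\<Sum>\<sigma> | \<sigma> permutes A \<and> \<sigma> k = l. h \<sigma> * ln (h \<sigma>))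
        - G l * (ln (G l) - ln (fact (card (A - {k})))))"
    using k unfolding perm_ent_def G_def by (intro sum.cong refl) (simp add: sum_fiber)
  also have "\<dots> = (\<Sum>\<sigma> | \<sigma> permutes A. h \<sigma> * ln (h \<sigma>)) - (\<Sum>l\<in>A. G l * ln (G l))
      + sum G A * ln (fact (card (A - {k})))"
    by (simp add: sum_fibers[OF fin k, of "\<lambda>\<sigma>. h \<sigma> * ln (h \<sigma>)"] sum_subtractf
        right_diff_distrib sum_distrib_right)
  finally have cond: "(\<Sum>l\<in>A. perm_ent (A - {k}) (\<lambda>\<sigma>. h (transpose k l \<circ> \<sigma>))) = \<dots>" .
  have "(\<Sum>\<sigma> | \<sigma> permutes A. h \<sigma>) = sum G A"
    unfolding G_def by (rule sum_fibers[OF fin k])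
  then show ?thesis
    unfolding cond by (simp add: perm_ent_def N algebra_simps)
qed

lemma sum_sym_div_fibers_le:
  fixes h :: "('a \<Rightarrow> 'a) \<Rightarrow> real"
  assumes fin: "finite A" and k: "k \<in> A" and h: "\<And>\<sigma>. h \<sigma> > 0"
  defines "G \<equiv> \<lambda>l. \<Sum>\<sigma> | \<sigma> permutes A \<and> \<sigma> k = l. h \<sigma>"
  shows "(\<Sum>l\<in>A. \<Sum>m\<in>A. sym_div (G l) (G m)) \<le> (\<Sum>j\<in>A. perm_form A h k j)"
proof -
  have fiber: "finite {\<sigma>. \<sigma> permutes A \<and> \<sigma> k = l}" for l
    using finite_permutations[OF fin] by (rule rev_finite_subset) auto
  have "(\<Sum>l\<in>A. \<Sum>m\<in>A. sym_div (G l) (G m)) \<le>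
      (\<Sum>l\<in>A. \<Sum>m\<in>A. \<Sum>\<sigma> | \<sigma> permutes A \<and> \<sigma> k = l. sym_div (h \<sigma>) (h (transpose l m \<circ> \<sigma>)))"
  proof (intro sum_mono)
    fix l m assume "l \<in> A" "m \<in> A"
    then show "sym_div (G l) (G m) \<le>
        (\<Sum>\<sigma> | \<sigma> permutes A \<and> \<sigma> k = l. sym_div (h \<sigma>) (h (transpose l m \<circ> \<sigma>)))"
      unfolding G_def sum_fiber_shift[OF \<open>l \<in> A\<close> \<open>m \<in> A\<close>]
      using h fiber by (intro sym_div_sum_le) auto
  qed
  \<comment> \<open>On each fiber \<open>l\<close> may be written as \<open>\<sigma> k\<close>; the
    summand then no longer mentions the fiber, and the fibers reassemble.\<close>
  also have "\<dots> = (\<Sum>l\<in>A. \<Sum>\<sigma> | \<sigma> permutes A \<and> \<sigma> k = l.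
      \<Sum>m\<in>A. sym_div (h \<sigma>) (h (transpose (\<sigma> k) m \<circ> \<sigma>)))"
    by (subst sum.swap) (auto intro!: sum.cong)
  also have "\<dots> = (\<Sum>\<sigma> | \<sigma> permutes A. \<Sum>m\<in>A. sym_div (h \<sigma>) (h (transpose (\<sigma> k) m \<circ> \<sigma>)))"
    by (rule sum_fibers[OF fin k, symmetric])
  also have "\<dots> = (\<Sum>\<sigma> | \<sigma> permutes A. \<Sum>j\<in>A. sym_div (h \<sigma>) (h (\<sigma> \<circ> transpose k j)))"
  proof (rule sum.cong[OF refl])
    fix \<sigma> assume "\<sigma> \<in> {\<sigma>. \<sigma> permutes A}"
    then have \<sigma>: "\<sigma> permutes A"
      by simp
    \<comment> \<open>Exchanging two values on the left is exchanging their positions on the right,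
      so the coupling produces exactly the transpositions involving \<open>k\<close>.\<close>
    have "transpose (\<sigma> k) (\<sigma> j) \<circ> \<sigma> = \<sigma> \<circ> transpose k j" for j
      using permutes_inj[OF \<sigma>] by (auto simp: fun_eq_iff Transposition.transpose_def inj_eq)
    then show "(\<Sum>m\<in>A. sym_div (h \<sigma>) (h (transpose (\<sigma> k) m \<circ> \<sigma>))) =
        (\<Sum>j\<in>A. sym_div (h \<sigma>) (h (\<sigma> \<circ> transpose k j)))"
      using sum.reindex_bij_betw[OF permutes_imp_bij[OF \<sigma>],
          of "\<lambda>m. sym_div (h \<sigma>) (h (transpose (\<sigma> k) m \<circ> \<sigma>))"] by simp
  qed
  also have "\<dots> = (\<Sum>j\<in>A. perm_form A h k j)"
    unfolding perm_form_def by (rule sum.swap)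
  finally show ?thesis .
qed

text \<open>Left multiplication by \<open>transpose k l\<close> commutes with right multiplication
  by \<open>transpose i j\<close>.\<close>

lemma perm_form_fibers:
  assumes "finite A" "k \<in> A" "i \<noteq> k" "j \<noteq> k"
  shows "(\<Sum>l\<in>A. perm_form (A - {k}) (\<lambda>\<sigma>. h (transpose k l \<circ> \<sigma>)) i j) = perm_form A h i j"
  using assms by (simp add: perm_form_def sum_fibers sum_fiber comp_assoc)

text \<open>A pair of distinct indices survives the removal of \<open>k\<close> for all but two
  choices of \<open>k\<close>; the diagonal contributes nothing.\<close>

lemma sum_sum_remove:
  fixes s :: "'a \<Rightarrow> 'a \<Rightarrow> real"
  assumes "finite A" "\<And>i. s i i = 0"
  shows "(\<Sum>k\<in>A. \<Sum>i\<in>A - {k}. \<Sum>j\<in>A - {k}. s i j) =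
    (real (card A) - 2) * (\<Sum>i\<in>A. \<Sum>j\<in>A. s i j)"
proof -
  have "(\<Sum>i\<in>A - {k}. \<Sum>j\<in>A - {k}. s i j) =
      (\<Sum>i\<in>A. \<Sum>j\<in>A. s i j) - (\<Sum>j\<in>A. s k j) - (\<Sum>i\<in>A. s i k)" if "k \<in> A" for k
    using assms that by (simp add: sum_diff1 sum_subtractf)
  then have "(\<Sum>k\<in>A. \<Sum>i\<in>A - {k}. \<Sum>j\<in>A - {k}. s i j) =
      (\<Sum>k\<in>A. (\<Sum>i\<in>A. \<Sum>j\<in>A. s i j) - (\<Sum>j\<in>A. s k j) - (\<Sum>i\<in>A. s i k))"
    by simp
  also have "\<dots> = (real (card A) - 2) * (\<Sum>i\<in>A. \<Sum>j\<in>A. s i j)"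
    using sum.swap[of "\<lambda>k i. s i k" A A] by (simp add: sum_subtractf left_diff_distrib)
  finally show ?thesis .
qed

text \<open>Arbitrary finite sets \<open>A\<close> replace intervals because the induction
  hypothesis is used on \<open>A - {k}\<close> for every \<open>k\<close>.\<close>

theorem perm_ent_le_perm_form:
  assumes "finite A" and h: "\<And>\<sigma>. h \<sigma> > 0"
  shows "real (card A) * perm_ent A h \<le> (\<Sum>i\<in>A. \<Sum>j\<in>A. perm_form A h i j) / 2"
  using assms
proof (induction "card A" arbitrary: A h)
  case 0
  then show ?case by simp
next
  case (Suc m)
  let ?n = "real (card A)" and ?T = "\<Sum>i\<in>A. \<Sum>j\<in>A. perm_form A h i j"
  show ?case
  proof (cases "m = 0")
    \<comment> \<open>A singleton has one permutation, hence zero entropy; it is separate because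
      the step below divides by \<open>m\<close>.\<close>
    case True
    then obtain a where "A = {a}"
      using Suc.hyps(2) by (metis One_nat_def card_1_singletonE)
    moreover have "{\<sigma>. \<sigma> permutes {a}} = {id}"
      by auto
    ultimately show ?thesis
      by (simp add: perm_ent_def)
  next
    case False
    then have m: "real m > 0" and n: "?n = real m + 1"
      using Suc.hyps(2) by auto
    have step: "perm_ent A h \<le> (\<Sum>i\<in>A - {k}. \<Sum>j\<in>A - {k}. perm_form A h i j) / (2 * real m)
        + (\<Sum>j\<in>A. perm_form A h k j) / (2 * ?n)" if k: "k \<in> A" for k
    proof -
      define G where "G l = (\<Sum>\<sigma> | \<sigma> permutes A \<and> \<sigma> k = l. h \<sigma>)" for l
      let ?h = "\<lambda>l \<sigma>. h (transpose k l \<circ> \<sigma>)"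
      have G: "G l > 0" if "l \<in> A" for l
        unfolding G_def sum_fiber[OF k that] using Suc.prems(1)
        by (intro sum_pos Suc.prems(2)) (auto simp: finite_permutations intro: permutes_id)
      have card: "card (A - {k}) = m"
        using k Suc.hyps(2) by (simp add: card_Diff_singleton)
      have "perm_ent (A - {k}) (?h l) \<le>
          (\<Sum>i\<in>A - {k}. \<Sum>j\<in>A - {k}. perm_form (A - {k}) (?h l) i j) / (2 * real m)" for l
        using Suc.hyps(1)[of "A - {k}" "?h l"] Suc.prems card m by (simp add: field_simps)
      then have "(\<Sum>l\<in>A. perm_ent (A - {k}) (?h l)) \<le> (\<Sum>l\<in>A.
          (\<Sum>i\<in>A - {k}. \<Sum>j\<in>A - {k}. perm_form (A - {k}) (?h l) i j) / (2 * real m))"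
        by (intro sum_mono)
      also have "\<dots> = (\<Sum>i\<in>A - {k}. \<Sum>j\<in>A - {k}. \<Sum>l\<in>A.
          perm_form (A - {k}) (?h l) i j) / (2 * real m)"
        unfolding sum_divide_distrib[symmetric] by (subst sum.swap, subst (2) sum.swap) simp
      also have "\<dots> = (\<Sum>i\<in>A - {k}. \<Sum>j\<in>A - {k}. perm_form A h i j) / (2 * real m)"
        using Suc.prems(1) k by (simp add: perm_form_fibers)
      finally have 1: "(\<Sum>l\<in>A. perm_ent (A - {k}) (?h l)) \<le>
        (\<Sum>i\<in>A - {k}. \<Sum>j\<in>A - {k}. perm_form A h i j) / (2 * real m)" .
      have "(\<Sum>l\<in>A. G l * ln (G l)) - sum G A * (ln (sum G A) - ln ?n) \<le>
          (\<Sum>l\<in>A. \<Sum>m\<in>A. sym_div (G l) (G m)) / (2 * ?n)"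
        using Suc.prems(1) k G by (intro sum_ln_le_sum_sym_div) auto
      also have "\<dots> \<le> (\<Sum>j\<in>A. perm_form A h k j) / (2 * ?n)"
        unfolding G_def using sum_sym_div_fibers_le[OF Suc.prems(1) k Suc.prems(2)]
        by (intro divide_right_mono) auto
      finally have 2: "(\<Sum>l\<in>A. G l * ln (G l)) - sum G A * (ln (sum G A) - ln ?n) \<le>
        (\<Sum>j\<in>A. perm_form A h k j) / (2 * ?n)" .
      show ?thesis
        unfolding perm_ent_chain[OF Suc.prems(1) k, of h, folded G_def]
        using 1 2 by (rule add_mono)
    qed
    have "?n * perm_ent A h = (\<Sum>k\<in>A. perm_ent A h)"
      by simp
    also have "\<dots> \<le> (\<Sum>k\<in>A. (\<Sum>i\<in>A - {k}. \<Sum>j\<in>A - {k}. perm_form A h i j) / (2 * real m)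
        + (\<Sum>j\<in>A. perm_form A h k j) / (2 * ?n))"
      by (intro sum_mono step)
    also have "\<dots> = (\<Sum>k\<in>A. \<Sum>i\<in>A - {k}. \<Sum>j\<in>A - {k}. perm_form A h i j) / (2 * real m)
        + ?T / (2 * ?n)"
      by (simp only: sum.distrib sum_divide_distrib[symmetric])
    \<comment> \<open>Each pair of distinct indices is counted \<open>card A - 2 = m - 1\<close>
      times in the first sum.\<close>
    also have "\<dots> = ((real m - 1) / real m + 1 / (real m + 1)) * (?T / 2)"
      unfolding sum_sum_remove[OF Suc.prems(1) perm_form_same[of A h]] n
      by (simp add: distrib_right del: distrib_left_numeral)
    also have "\<dots> \<le> 1 * (?T / 2)"
    proof (rule mult_right_mono)
      \<comment> \<open>This is \<open>1 / (m + 1) \<le> 1 / m\<close>.\<close>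
      show "(real m - 1) / real m + 1 / (real m + 1) \<le> 1"
        using m by (simp add: diff_divide_distrib frac_le)
      show "0 \<le> ?T / 2"
        using Suc.prems(2) by (simp add: sum_nonneg perm_form_nonneg)
    qed
    finally show ?thesis by simp
  qed
qed

section \<open>From the Dirichlet form to squared differences\<close>

text \<open>The trapezoidal rule overestimates the integral of the convex function
  \<open>exp\<close> over the interval from \<open>b\<close> to \<open>a\<close>.\<close>

lemma exp_diff_le_mean:
  fixes a b :: real
  assumes "b \<le> a"
  shows "exp a - exp b \<le> (a - b) * (exp a + exp b) / 2"
proof -
  \<comment> \<open>Twice the trapezoidal error, divided by \<open>exp b\<close>, as a function of
    \<open>x = a - b\<close>. It vanishes at 0, and its derivative is nonnegative by
    \<open>1 - x \<le> exp (- x)\<close>.\<close>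
  define \<phi> where "\<phi> x = x * (exp x + 1) - 2 * (exp x - 1)" for x :: real
  have "\<phi> 0 \<le> \<phi> (a - b)"
  proof (rule DERIV_nonneg_imp_nondecreasing[of 0 "a - b" \<phi>])
    fix x :: real
    have "(\<phi> has_real_derivative (1 + (x - 1) * exp x)) (at x)"
      unfolding \<phi>_def by (auto intro!: derivative_eq_intros simp: algebra_simps)
    moreover have "(1 - x) * exp x \<le> exp (- x) * exp x"
      using exp_ge_add_one_self[of "- x"] by (intro mult_right_mono) auto
    then have "1 + (x - 1) * exp x \<ge> 0"
      by (simp add: algebra_simps flip: exp_add)
    ultimately show "\<exists>y. (\<phi> has_real_derivative y) (at x) \<and> y \<ge> 0"
      by blast
  qed (use assms in auto)
  then have "0 \<le> \<phi> (a - b) * exp b"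
    by (simp add: \<phi>_def)
  also have "\<dots> = (a - b) * (exp a + exp b) - 2 * (exp a - exp b)"
    by (simp add: \<phi>_def exp_diff field_simps)
  finally show ?thesis
    by simp
qed

lemma sym_div_exp_le: "sym_div (exp a) (exp b) \<le> (a - b)\<^sup>2 * (exp a + exp b) / 2"
proof (cases "b \<le> a")
  case True
  then show ?thesis
    using mult_right_mono[OF exp_diff_le_mean[OF True], of "a - b"]
    by (simp add: sym_div_def power2_eq_square mult_ac)
next
  case False
  then show ?thesis
    using mult_right_mono[OF exp_diff_le_mean[of a b], of "b - a"]
    by (simp add: sym_div_def power2_eq_square algebra_simps)
qed

text \<open>\<open>sym_div_exp_le\<close> gives the average of \<open>?F\<close> at
  \<open>\<sigma>\<close> and at \<open>\<sigma> \<circ> transpose i j\<close>; both halves have the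
  same sum, since right multiplication permutes the summands.\<close>

lemma perm_form_exp_le:
  assumes "i \<in> A" "j \<in> A"
  shows "perm_form A (\<lambda>\<sigma>. exp (f \<sigma>)) i j \<le>
    (\<Sum>\<sigma> | \<sigma> permutes A. (f \<sigma> - f (\<sigma> \<circ> transpose i j))\<^sup>2 * exp (f \<sigma>))"
proof -
  let ?F = "\<lambda>\<sigma>. (f \<sigma> - f (\<sigma> \<circ> transpose i j))\<^sup>2 * exp (f \<sigma>)"
  have tt: "\<sigma> \<circ> transpose i j \<circ> transpose i j = \<sigma>" for \<sigma> :: "'a \<Rightarrow> 'a"
    by (simp add: fun_eq_iff)
  have "perm_form A (\<lambda>\<sigma>. exp (f \<sigma>)) i j \<le>
      (\<Sum>\<sigma> | \<sigma> permutes A. (?F \<sigma> + ?F (\<sigma> \<circ> transpose i j)) / 2)"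
    unfolding perm_form_def
  proof (rule sum_mono)
    fix \<sigma>
    show "sym_div (exp (f \<sigma>)) (exp (f (\<sigma> \<circ> transpose i j))) \<le>
        (?F \<sigma> + ?F (\<sigma> \<circ> transpose i j)) / 2"
      using sym_div_exp_le[of "f \<sigma>" "f (\<sigma> \<circ> transpose i j)"]
      by (simp add: tt power2_commute[of "f (\<sigma> \<circ> transpose i j)"] distrib_left)
  qed
  also have "\<dots> = (\<Sum>\<sigma> | \<sigma> permutes A. ?F \<sigma>)"
    using sum_permutations_shift[OF assms, of ?F]
    by (simp add: sum.distrib flip: sum_divide_distrib)
  finally show ?thesis .
qed

text \<open>Each squared difference is charged to whichever of \<open>\<sigma>\<close> and
  \<open>\<sigma> \<circ> transpose i j\<close> has the larger \<open>f\<close>, where the weight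
  \<open>exp f\<close> is larger too. Both members of the pair are charged there, whence the factor
  2.\<close>

lemma sum_square_exp_le_sum_pos_part:
  assumes "i \<in> A" "j \<in> A"
  shows "(\<Sum>\<sigma> | \<sigma> permutes A. (f \<sigma> - f (\<sigma> \<circ> transpose i j))\<^sup>2 * exp (f \<sigma>)) \<le>
    2 * (\<Sum>\<sigma> | \<sigma> permutes A. (max (f \<sigma> - f (\<sigma> \<circ> transpose i j)) 0)\<^sup>2 * exp (f \<sigma> :: real))"
proof -
  let ?F = "\<lambda>\<sigma>. (max (f \<sigma> - f (\<sigma> \<circ> transpose i j)) 0)\<^sup>2 * exp (f \<sigma>)"
  have tt: "\<sigma> \<circ> transpose i j \<circ> transpose i j = \<sigma>" for \<sigma> :: "'a \<Rightarrow> 'a"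
    by (simp add: fun_eq_iff)
  have "(\<Sum>\<sigma> | \<sigma> permutes A. (f \<sigma> - f (\<sigma> \<circ> transpose i j))\<^sup>2 * exp (f \<sigma>)) \<le>
      (\<Sum>\<sigma> | \<sigma> permutes A. ?F \<sigma> + ?F (\<sigma> \<circ> transpose i j))"
  proof (rule sum_mono)
    fix \<sigma>
    show "(f \<sigma> - f (\<sigma> \<circ> transpose i j))\<^sup>2 * exp (f \<sigma>) \<le> ?F \<sigma> + ?F (\<sigma> \<circ> transpose i j)"
    proof (cases "f (\<sigma> \<circ> transpose i j) \<le> f \<sigma>")
      case False
      then show ?thesis
        unfolding tt power2_commute[of "f \<sigma>"] by (simp add: mult_left_mono)
    qed (simp add: tt)
  qed
  also have "\<dots> = 2 * (\<Sum>\<sigma> | \<sigma> permutes A. ?F \<sigma>)"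
    using sum_permutations_shift[OF assms, of ?F] by (simp add: sum.distrib)
  finally show ?thesis .
qed

section \<open>Transfer to the uniform measure on \<open>Sym n\<close>\<close>

lemma finite_Sym: "finite (Sym n)"
  by (simp add: Sym_def finite_permutations)

lemma card_Sym: "card (Sym n) = fact n"
  by (simp add: Sym_def card_permutations)

lemma integral_unif_Sym: "(\<integral>\<sigma>. F \<sigma> \<partial>unif_Sym n) = (\<Sum>\<sigma>\<in>Sym n. F \<sigma>) / fact n" for F :: "_ \<Rightarrow> real"
proof -
  have "Sym n \<noteq> {}"
    using card_Sym[of n] by force
  then show ?thesis
    by (simp add: unif_Sym_def integral_pmf_of_set finite_Sym card_Sym)
qed

lemma Ent_unif_Sym:
  assumes "\<And>\<sigma>. h \<sigma> > 0"
  shows "Ent (unif_Sym n) h = perm_ent {1..n} h / fact n"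
proof -
  have "(\<Sum>\<sigma>\<in>Sym n. h \<sigma>) > 0"
    using card_Sym[of n] assms by (intro sum_pos finite_Sym) force+
  then show ?thesis
    by (simp add: Ent_def integral_unif_Sym perm_ent_def ln_div diff_divide_distrib Sym_def)
qed

text \<open>Serves both gradients: \<open>S\<close> is the squared difference or its positive part
  squared, \<open>w\<close> the weight \<open>exp f\<close>. Nonnegativity of \<open>S\<close> lets
  the square undo \<open>sqrt\<close>.\<close>

lemma integral_unif_Sym_double_sum:
  fixes S :: "(nat \<Rightarrow> nat) \<Rightarrow> nat \<Rightarrow> nat \<Rightarrow> real"
  assumes "\<And>\<sigma> i j. S \<sigma> i j \<ge> 0"
  shows "(\<integral>\<sigma>. (sqrt (1 / real n * (\<Sum>i=1..n. \<Sum>j=1..n. S \<sigma> i j)))\<^sup>2 * w \<sigma> \<partial>unif_Sym n) =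
    (\<Sum>i=1..n. \<Sum>j=1..n. \<Sum>\<sigma> | \<sigma> permutes {1..n}. S \<sigma> i j * w \<sigma>) / (real n * fact n)"
proof -
  have "(\<Sum>\<sigma>\<in>Sym n. (\<Sum>i=1..n. \<Sum>j=1..n. S \<sigma> i j) * w \<sigma>) =
      (\<Sum>i=1..n. \<Sum>j=1..n. \<Sum>\<sigma>\<in>Sym n. S \<sigma> i j * w \<sigma>)"
    unfolding sum_distrib_right by (subst sum.swap, subst (2) sum.swap) simp
  moreover have "(sqrt (1 / real n * (\<Sum>i=1..n. \<Sum>j=1..n. S \<sigma> i j)))\<^sup>2 =
      1 / real n * (\<Sum>i=1..n. \<Sum>j=1..n. S \<sigma> i j)" for \<sigma>
    using assms by (intro real_sqrt_pow2 mult_nonneg_nonneg sum_nonneg) auto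
  ultimately show ?thesis
    by (simp add: integral_unif_Sym Sym_def flip: sum_divide_distrib)
qed

lemma Ent_exp_le_Gamma_Sym:
  assumes "n \<ge> 1"
  shows "Ent (unif_Sym n) (\<lambda>\<sigma>. exp (f \<sigma>)) \<le>
    1 / 2 * (\<integral>\<sigma>. (Gamma_Sym n f \<sigma>)\<^sup>2 * exp (f \<sigma>) \<partial>unif_Sym n)"
proof -
  have "real n * perm_ent {1..n} (\<lambda>\<sigma>. exp (f \<sigma>)) \<le>
      (\<Sum>i=1..n. \<Sum>j=1..n. perm_form {1..n} (\<lambda>\<sigma>. exp (f \<sigma>)) i j) / 2"
    using perm_ent_le_perm_form[of "{1..n}" "\<lambda>\<sigma>. exp (f \<sigma>)"] by simp
  also have "\<dots> \<le> (\<Sum>i=1..n. \<Sum>j=1..n. \<Sum>\<sigma> | \<sigma> permutes {1..n}.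
      (f \<sigma> - f (\<sigma> \<circ> transpose i j))\<^sup>2 * exp (f \<sigma>)) / 2"
    by (intro divide_right_mono sum_mono perm_form_exp_le) auto
  finally show ?thesis
    using assms unfolding Gamma_Sym_def
    by (subst integral_unif_Sym_double_sum) (auto simp: Ent_unif_Sym field_simps)
qed

text \<open>Reduces the one-sided inequality to the two-sided one: the factor 2 turns the constant
  1/2 into 1.\<close>

lemma integral_Gamma_Sym_le_Gamma_Sym_plus:
  "(\<integral>\<sigma>. (Gamma_Sym n f \<sigma>)\<^sup>2 * exp (f \<sigma>) \<partial>unif_Sym n) \<le>
    2 * (\<integral>\<sigma>. (Gamma_Sym_plus n f \<sigma>)\<^sup>2 * exp (f \<sigma>) \<partial>unif_Sym n)"
proof -
  have "(\<Sum>i=1..n. \<Sum>j=1..n. \<Sum>\<sigma> | \<sigma> permutes {1..n}.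
      (f \<sigma> - f (\<sigma> \<circ> transpose i j))\<^sup>2 * exp (f \<sigma>)) \<le>
    2 * (\<Sum>i=1..n. \<Sum>j=1..n. \<Sum>\<sigma> | \<sigma> permutes {1..n}.
      (max (f \<sigma> - f (\<sigma> \<circ> transpose i j)) 0)\<^sup>2 * exp (f \<sigma>))"
    unfolding sum_distrib_left[of 2]
    by (intro sum_mono order.trans[OF sum_square_exp_le_sum_pos_part]) (auto simp: sum_distrib_left)
  from divide_right_mono[OF this, of "real n * fact n"] show ?thesis
    unfolding Gamma_Sym_def Gamma_Sym_plus_def
    by (subst (1 2) integral_unif_Sym_double_sum) auto
qed

theorem proposition1p6:
  fixes n :: nat
  assumes "n \<ge> 1"
  shows "mLSI (unif_Sym n) UNIV (Gamma_Sym n) 1 \<and>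
    mLSI (unif_Sym n) UNIV (Gamma_Sym_plus n) 2 \<and>
    (\<forall>f :: (nat \<Rightarrow> nat) \<Rightarrow> real.
      Ent (unif_Sym n) (\<lambda>\<sigma>. exp (f \<sigma>))
        \<le> 1 / 2 * (\<integral>\<sigma>. (Gamma_Sym n f \<sigma>)\<^sup>2 * exp (f \<sigma>) \<partial>unif_Sym n) \<and>
      Ent (unif_Sym n) (\<lambda>\<sigma>. exp (f \<sigma>))
        \<le> (\<integral>\<sigma>. (Gamma_Sym_plus n f \<sigma>)\<^sup>2 * exp (f \<sigma>) \<partial>unif_Sym n))"
proof -
  have "prob_space (unif_Sym n)"
    unfolding unif_Sym_def by (rule prob_space_measure_pmf)
  moreover have "Ent (unif_Sym n) (\<lambda>\<sigma>. exp (f \<sigma>))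
      \<le> (\<integral>\<sigma>. (Gamma_Sym_plus n f \<sigma>)\<^sup>2 * exp (f \<sigma>) \<partial>unif_Sym n)" for f
    using Ent_exp_le_Gamma_Sym[OF assms, of f] integral_Gamma_Sym_le_Gamma_Sym_plus[of n f]
    by linarith
  ultimately show ?thesis
    using Ent_exp_le_Gamma_Sym[OF assms] by (auto simp: mLSI_def)
qed

end
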